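(* Let $k \ge 2$ and $n \ge 0$ be integers. Define $b_k(0)=b_k(1)=1$ and $b_k(m) = k\cdot b_k(m-1) + b_k(m-2)$ for $m \ge 2$. Then $$b_k(n) = |\mathsf{Av}^k_n(122, 213)|,$$ where $\mathsf{Av}^k_n(122,213)$ is the set of $k$-regular words over $[n]$ that avoid both patterns $122$ and $213$.
   Context: For an integer $n\ge 0$ let $[n]=\{1,2,\ldots,n\}$. A $k$-regular word over $[n]$ is a word of length $kn$ in which each symbol of $[n]$ appears exactly $k$ times (for $n=0$ the only such word is the empty word). A word $w=w_1\cdots w_N$ contains a pattern $p=p_1\cdots p_r$ if there are indices $i_1<\cdots<i_r$ such that $w_{i_1}\cdots w_{i_r}$ is order isomorphic to $p$, i.e. for all $s,t$: $w_{i_s}<w_{i_t}$ iff $p_s<p_t$, and $w_{i_s}=w_{i_t}$ iff $p_s=p_t$. Otherwise $w$ avoids $p$. $\mathsf{Av}^k_n(\pi_1,\ldots,\pi_m)$ denotes the set of $k$-regular words over $[n]$ that avoid all of $\pi_1,\ldots,\pi_m$. *)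

theory Defs
  imports Main
begin

text \<open>Words and patterns are lists of natural numbers; positions are counted from 0.\<close>

definition k_regular :: "nat \<Rightarrow> nat \<Rightarrow> nat list \<Rightarrow> bool" where
  "k_regular k n w \<longleftrightarrow>
     length w = k * n \<and> set w \<subseteq> {1..n} \<and> (\<forall>a\<in>{1..n}. count_list w a = k)"

definition order_iso :: "nat list \<Rightarrow> nat list \<Rightarrow> bool" where
  "order_iso u p \<longleftrightarrow> length u = length p \<and>
     (\<forall>s<length p. \<forall>t<length p.
        (u ! s < u ! t \<longleftrightarrow> p ! s < p ! t) \<and> (u ! s = u ! t \<longleftrightarrow> p ! s = p ! t))"

text \<open>The list \<open>is\<close> holds the increasing positions of the occurrence; they need not be
  adjacent.\<close>

definition contains :: "nat list \<Rightarrow> nat list \<Rightarrow> bool" where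
  "contains w p \<longleftrightarrow>
     (\<exists>is. sorted_wrt (<) is \<and> set is \<subseteq> {..<length w} \<and> order_iso (map ((!) w) is) p)"

definition Av :: "nat \<Rightarrow> nat \<Rightarrow> nat list set \<Rightarrow> nat list set" where
  "Av k n P = {w. k_regular k n w \<and> (\<forall>p\<in>P. \<not> contains w p)}"

fun b :: "nat \<Rightarrow> nat \<Rightarrow> nat" where
  "b k 0 = 1"
| "b k (Suc 0) = 1"
| "b k (Suc (Suc m)) = k * b k (Suc m) + b k m"

end

theory Submission
  imports Defs "HOL-Library.Sublist"
begin

text \<open>
  The count obeys a pair of recurrences obtained by looking at the smallest letter. Take an
  avoiding \<open>k\<close>-regular word \<open>w\<close> over \<open>[n+1]\<close> and cut it at its first \<open>1\<close>. Avoiding \<open>122\<close> allows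
  every larger letter at most once after the cut; as \<open>k \<ge> 2\<close>, every larger letter therefore also
  occurs before the cut, in particular the letter \<open>2\<close>. Now \<open>2 1 c\<close> with \<open>c \<ge> 3\<close> is an occurrence of
  \<open>213\<close>, so only ones and at most one \<open>2\<close> follow the cut. Hence, with \<open>v\<close> the word obtained from \<open>w\<close>
  by erasing the ones, either \<open>w = v 1\<dots>1\<close>, or \<open>v = v' 2\<close> and \<open>w\<close> arises from \<open>v' 1\<dots>1\<close> by inserting
  the letter \<open>2\<close> behind one of the \<open>k\<close> ones. Conversely all these words avoid both patterns as soon
  as \<open>v\<close> does, and \<open>v\<close>, with its letters lowered by one, ranges over the avoiding words over \<open>[n]\<close>.

  Let \<open>a n\<close> be the number of avoiding words and \<open>c n\<close> the number of those that end in \<open>1\<close>. The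
  description gives \<open>a (n+1) = a n + k * c n\<close>, and, because a word of the second kind ends in \<open>1\<close>
  unless the \<open>2\<close> stands behind the last one, \<open>c (n+1) = a n + (k-1) * c n\<close>
  (\<open>card_avoiders_Suc\<close>, \<open>card_avoider_stems_Suc\<close>). Eliminating \<open>c\<close> by means of
  \<open>a (n+1) = c (n+1) + c n\<close> yields \<open>a (n+2) = k * a (n+1) + a n\<close>.
\<close>

section \<open>Pattern containment by subsequences\<close>

text \<open>Increasing lists of positions and subsequences are the same thing; subsequences are the more
  convenient form because they are compatible with filtering and mapping.\<close>

lemma subseq_iff_increasing_positions:
  "subseq u w \<longleftrightarrow>
     (\<exists>is. sorted_wrt (<) is \<and> set is \<subseteq> {..<length w} \<and> map ((!) w) is = u)"
proof
  assume "subseq u w"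
  then show "\<exists>is. sorted_wrt (<) is \<and> set is \<subseteq> {..<length w} \<and> map ((!) w) is = u"
  proof (induction rule: list_emb.induct)
    case (list_emb_Nil ys)
    then show ?case by (intro exI[of _ "[]"]) simp
  next
    case (list_emb_Cons xs ys y)
    then obtain js where "sorted_wrt (<) js" "set js \<subseteq> {..<length ys}" "map ((!) ys) js = xs"
      by blast
    then show ?case
      by (intro exI[of _ "map Suc js"]) (auto simp: sorted_wrt_map)
  next
    case (list_emb_Cons2 x y xs ys)
    then obtain js where "sorted_wrt (<) js" "set js \<subseteq> {..<length ys}" "map ((!) ys) js = xs"
      by blast
    with list_emb_Cons2 show ?case
      by (intro exI[of _ "0 # map Suc js"]) (auto simp: sorted_wrt_map)
  qed
next
  assume "\<exists>is. sorted_wrt (<) is \<and> set is \<subseteq> {..<length w} \<and> map ((!) w) is = u"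
  then obtain js where js: "sorted_wrt (<) js" "set js \<subseteq> {..<length w}" "map ((!) w) js = u"
    by blast
  have "subseq js [0..<length w]"
  proof -
    have "sorted_list_of_set (set js) = js"
      using js(1) by (simp add: sorted_list_of_set.idem_if_sorted_distinct strict_sorted_iff)
    moreover have "filter (\<lambda>i. i \<in> set js) [0..<length w] = sorted_list_of_set (set js)"
      using js(2) by (intro sorted_distinct_set_unique) (auto simp: sorted_wrt_filter)
    ultimately show ?thesis by (metis subseq_filter_left)
  qed
  then have "subseq (map ((!) w) js) (map ((!) w) [0..<length w])"
    by (rule subseq_map)
  then show "subseq u w"
    using js(3) by (simp add: map_nth)
qed

lemma contains_iff_subseq: "contains w p \<longleftrightarrow> (\<exists>u. subseq u w \<and> order_iso u p)"
  unfolding contains_def subseq_iff_increasing_positions by auto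

lemma length_3_obtain:
  assumes "length u = 3"
  obtains x y z where "u = [x, y, z]"
  using assms by (auto simp: length_Suc_conv eval_nat_numeral)

lemma order_iso_122:
  "order_iso u [1, 2, 2] \<longleftrightarrow> (\<exists>x y. x < y \<and> u = [x, y, y])"
proof -
  have triple: "order_iso [x, y, z] [1, 2, 2] \<longleftrightarrow> x < y \<and> y = z" for x y z
    by (auto simp: order_iso_def All_less_Suc numeral_3_eq_3)
  have "length u = 3" if "order_iso u [1, 2, 2]"
    using that by (simp add: order_iso_def)
  with triple show ?thesis
    by (metis length_3_obtain)
qed

lemma order_iso_213:
  "order_iso u [2, 1, 3] \<longleftrightarrow> (\<exists>x y z. y < x \<and> x < z \<and> u = [x, y, z])"
proof -
  have triple: "order_iso [x, y, z] [2, 1, 3] \<longleftrightarrow> y < x \<and> x < z" for x y z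
    by (auto simp: order_iso_def All_less_Suc numeral_3_eq_3)
  have "length u = 3" if "order_iso u [2, 1, 3]"
    using that by (simp add: order_iso_def)
  with triple show ?thesis
    by (metis length_3_obtain)
qed

definition avoids_122_213 :: "nat list \<Rightarrow> bool" where
  "avoids_122_213 w \<longleftrightarrow>
     (\<forall>x y. x < y \<longrightarrow> \<not> subseq [x, y, y] w) \<and>
     (\<forall>x y z. y < x \<longrightarrow> x < z \<longrightarrow> \<not> subseq [x, y, z] w)"

lemma avoids_iff_not_contains:
  "avoids_122_213 w \<longleftrightarrow> (\<forall>p\<in>{[1, 2, 2], [2, 1, 3]}. \<not> contains w p)"
  unfolding avoids_122_213_def contains_iff_subseq
  unfolding ball_simps order_iso_122 order_iso_213 by blast

lemma avoids_subseq: "avoids_122_213 w \<Longrightarrow> subseq v w \<Longrightarrow> avoids_122_213 v"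
  unfolding avoids_122_213_def by (meson subseq_order.trans)

lemma avoids_map_Suc [simp]: "avoids_122_213 (map Suc u) \<longleftrightarrow> avoids_122_213 u"
proof
  assume *: "avoids_122_213 (map Suc u)"
  have raise: "subseq (map Suc v) (map Suc u)" if "subseq v u" for v
    using that by (rule subseq_map)
  show "avoids_122_213 u"
    unfolding avoids_122_213_def
  proof (intro conjI allI impI notI)
    fix x y :: nat
    assume "x < y" "subseq [x, y, y] u"
    then have "Suc x < Suc y" "subseq [Suc x, Suc y, Suc y] (map Suc u)"
      using raise[of "[x, y, y]"] by simp_all
    with * show False unfolding avoids_122_213_def by blast
  next
    fix x y z :: nat
    assume "y < x" "x < z" "subseq [x, y, z] u"
    then have "Suc y < Suc x" "Suc x < Suc z" "subseq [Suc x, Suc y, Suc z] (map Suc u)"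
      using raise[of "[x, y, z]"] by simp_all
    with * show False unfolding avoids_122_213_def by blast
  qed
next
  assume *: "avoids_122_213 u"
  have lower: "subseq (map (\<lambda>x. x - 1) v) u" if "subseq v (map Suc u)" for v
    using subseq_map[OF that, of "\<lambda>x. x - 1"] by (simp add: o_def)
  have pos: "x > 0" if "subseq v (map Suc u)" "x \<in> set v" for v x
    using list_emb_set[OF that] by auto
  show "avoids_122_213 (map Suc u)"
    unfolding avoids_122_213_def
  proof (intro conjI allI impI notI)
    fix x y :: nat
    assume "x < y" and sub: "subseq [x, y, y] (map Suc u)"
    moreover have "x > 0" using pos[OF sub] by simp
    ultimately have "x - 1 < y - 1" "subseq [x - 1, y - 1, y - 1] u"
      using lower[OF sub] by simp_all
    with * show False unfolding avoids_122_213_def by blast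
  next
    fix x y z :: nat
    assume "y < x" "x < z" and sub: "subseq [x, y, z] (map Suc u)"
    moreover have "y > 0" using pos[OF sub] by simp
    ultimately have "y - 1 < x - 1" "x - 1 < z - 1" "subseq [x - 1, y - 1, z - 1] u"
      using lower[OF sub] by simp_all
    with * show False unfolding avoids_122_213_def by blast
  qed
qed

section \<open>Regular words\<close>

lemma k_regular_iff_count:
  "k_regular k n w \<longleftrightarrow> set w \<subseteq> {1..n} \<and> (\<forall>a\<in>{1..n}. count_list w a = k)"
proof -
  have "length w = k * n" if "set w \<subseteq> {1..n}" "\<forall>a\<in>{1..n}. count_list w a = k"
    using sum_count_set[OF that(1)] that(2) by (simp add: mult.commute)
  then show ?thesis by (auto simp: k_regular_def)
qed

definition avoiders :: "nat \<Rightarrow> nat \<Rightarrow> nat list set" where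
  "avoiders k n = {w. set w \<subseteq> {1..n} \<and> (\<forall>a\<in>{1..n}. count_list w a = k) \<and> avoids_122_213 w}"

lemma Av_eq_avoiders: "Av k n {[1, 2, 2], [2, 1, 3]} = avoiders k n"
  by (simp only: Av_def avoiders_def avoids_iff_not_contains k_regular_iff_count conj_assoc)

lemma finite_avoiders: "finite (avoiders k n)"
  unfolding Av_eq_avoiders[symmetric]
  by (rule finite_subset[OF _ finite_lists_length_eq[of "{1..n}" "k * n"]])
    (auto simp: Av_def k_regular_def)

lemma count_list_filter: "count_list (filter P w) a = (if P a then count_list w a else 0)"
  by (induction w) auto

lemma count_list_map_Suc: "count_list (map Suc u) (Suc a) = count_list u a"
  by (induction u) auto

lemma count_list_replicate: "count_list (replicate i x) a = (if x = a then i else 0)"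
  by (induction i) auto

section \<open>The position of the smallest letter\<close>

lemma subseq_Cons_append_Cons:
  assumes "x \<notin> set p"
  shows "subseq (x # v) (p @ x # s) \<longleftrightarrow> subseq v s"
  using assms by (induction p) auto

lemma subseq_pair_iff_count_list: "subseq [y, y] s \<longleftrightarrow> count_list s y \<ge> 2"
proof (induction s)
  case (Cons a s)
  have "count_list s y \<ge> 1 \<longleftrightarrow> y \<in> set s"
    by (metis count_list_0_iff less_one not_le)
  with Cons show ?case
    by (auto simp: subseq_singleton_left)
qed simp

text \<open>An occurrence of \<open>122\<close> or \<open>213\<close> that does not use the letter \<open>1\<close> survives the erasure of all
  ones. One that does use it has the \<open>1\<close> as its smallest letter, and then two equal letters, or a
  letter \<open>c \<ge> 3\<close>, would have to follow the first \<open>1\<close>.\<close>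

lemma avoids_if_tail_in_12:
  assumes "1 \<notin> set p" "0 \<notin> set p" "set s \<subseteq> {1, 2}" "count_list s 2 \<le> 1"
    and erased: "avoids_122_213 (filter (\<lambda>a. a \<noteq> 1) (p @ 1 # s))"
  shows "avoids_122_213 (p @ 1 # s)"
proof -
  let ?w = "p @ 1 # s"
  have erase: "subseq v (filter (\<lambda>a. a \<noteq> 1) ?w)" if "subseq v ?w" "1 \<notin> set v" for v
  proof -
    have "filter (\<lambda>a. a \<noteq> 1) v = v"
      using that(2) by (induction v) auto
    with subseq_filter[OF that(1)] show ?thesis by metis
  qed
  have pos: "a > 0" if "subseq v ?w" "a \<in> set v" for v a
    using list_emb_set[OF that] assms(2,3) by (metis Un_iff One_nat_def empty_iff gr0I insert_iff
        list.set(2) set_append subsetD zero_neq_numeral zero_neq_one)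
  have after_1: "subseq v s" if "subseq (1 # v) ?w" for v
    using that subseq_Cons_append_Cons[OF assms(1)] by blast
  show ?thesis
    unfolding avoids_122_213_def
  proof (intro conjI allI impI notI)
    fix x y :: nat
    assume "x < y" and sub: "subseq [x, y, y] ?w"
    show False
    proof (cases "x = 1")
      case True
      then have yy: "subseq [y, y] s" using sub after_1 by simp
      then have "y \<in> set s" using list_emb_set[OF yy, of y] by auto
      with \<open>x < y\<close> True assms(3) have "y = 2" by auto
      with yy assms(4) show False by (simp add: subseq_pair_iff_count_list)
    next
      case False
      with \<open>x < y\<close> pos[OF sub, of x] have "1 \<notin> set [x, y, y]" by auto
      with erase[OF sub] \<open>x < y\<close> erased show False
        unfolding avoids_122_213_def by blast
    qed
  next
    fix x y z :: nat
    assume "y < x" "x < z" and sub: "subseq [x, y, z] ?w"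
    show False
    proof (cases "y = 1")
      case True
      have "subseq (1 # [z]) ?w"
        using sub True by (metis subseq_Cons')
      then have "subseq [z] s" by (rule after_1)
      then have "z \<in> set s" by (simp only: subseq_singleton_left)
      with assms(3) \<open>y < x\<close> \<open>x < z\<close> True show False by auto
    next
      case False
      with \<open>y < x\<close> \<open>x < z\<close> pos[OF sub, of y] have "1 \<notin> set [x, y, z]" by auto
      with erase[OF sub] \<open>y < x\<close> \<open>x < z\<close> erased show False
        unfolding avoids_122_213_def by blast
    qed
  qed
qed

text \<open>Two equal larger letters behind the first \<open>1\<close> would form \<open>122\<close> with it. So at least \<open>k - 1 \<ge> 1\<close> copies
  of \<open>2\<close> stand in front of it, and a letter \<open>c \<ge> 3\<close> behind it would complete the occurrence \<open>2 1 c\<close>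
  of \<open>213\<close>. The hypothesis \<open>k \<ge> 2\<close> is essential: for \<open>k = 1\<close> the word \<open>1 2 3\<close> avoids both patterns.\<close>

lemma tail_in_12_if_in_avoiders:
  assumes w: "w \<in> avoiders k (Suc n)" "w = p @ 1 # s" "1 \<notin> set p"
    and "k \<ge> 2"
  shows "set s \<subseteq> {1, 2}" "count_list s 2 \<le> 1"
proof -
  note props = w(1)[unfolded avoiders_def mem_Collect_eq]
  have once: "count_list s y \<le> 1" if "y > 1" for y
  proof (rule ccontr)
    assume "\<not> count_list s y \<le> 1"
    then have "subseq (1 # [y, y]) w"
      unfolding w(2) subseq_Cons_append_Cons[OF w(3)] by (simp add: subseq_pair_iff_count_list)
    with that props show False unfolding avoids_122_213_def by blast
  qed
  show "count_list s 2 \<le> 1" using once by simp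
  show "set s \<subseteq> {1, 2}"
  proof
    fix c assume c: "c \<in> set s"
    show "c \<in> {1, 2}"
    proof (rule ccontr)
      assume "c \<notin> {1, 2}"
      with c props w(2) have "c \<ge> 3" "c \<le> Suc n" by (auto simp: subset_iff)
      then have "count_list w 2 = k" using props by simp
      with once[of 2] \<open>k \<ge> 2\<close> have "count_list p 2 > 0" by (simp add: w(2))
      then have "subseq [2] p"
        by (metis count_list_0_iff less_irrefl subseq_singleton_left)
      moreover have "subseq [1, c] (1 # s)"
        using c by (simp add: subseq_singleton_left)
      ultimately have "subseq ([2] @ [1, c]) w"
        unfolding w(2) by (rule list_emb_append_mono)
      with \<open>c \<ge> 3\<close> props show False
        unfolding avoids_122_213_def by (auto dest!: spec[of _ 2] spec[of _ 1] spec[of _ c])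
    qed
  qed
qed

section \<open>Raising an avoiding word\<close>

definition append_ones :: "nat \<Rightarrow> nat list \<Rightarrow> nat list" where
  "append_ones k u = map Suc u @ replicate k 1"

text \<open>Here \<open>u\<close> stands for the avoiding word \<open>u 1\<close>, whose final \<open>1\<close> is raised to the \<open>2\<close> that is put
  behind the \<open>i\<close>-th of the \<open>k\<close> new ones.\<close>

definition insert_two :: "nat \<Rightarrow> nat \<times> nat list \<Rightarrow> nat list" where
  "insert_two k = (\<lambda>(i, u). map Suc u @ replicate i 1 @ 2 # replicate (k - i) 1)"

text \<open>The final \<open>1\<close> is dropped because raising such a word moves this letter.\<close>

definition avoider_stems :: "nat \<Rightarrow> nat \<Rightarrow> nat list set" where
  "avoider_stems k n = {u. u @ [1] \<in> avoiders k n}"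

lemma filter_map_Suc: "filter (\<lambda>a. a \<noteq> 1) (map Suc u) = map Suc u" if "0 \<notin> set u"
  using that by (induction u) auto

lemma append_ones_in_avoiders:
  assumes "u \<in> avoiders k n" "k \<ge> 1"
  shows "append_ones k u \<in> avoiders k (Suc n)"
proof -
  note props = assms(1)[unfolded avoiders_def mem_Collect_eq]
  from props have pos: "0 \<notin> set u" by auto
  have "count_list (append_ones k u) a = k" if "a \<in> {1..Suc n}" for a
  proof (cases a)
    case (Suc a')
    with that props pos show ?thesis
      by (cases "a' = 0") (auto simp: append_ones_def count_list_map_Suc count_list_replicate
          count_list_0_iff simp flip: One_nat_def)
  qed (use that in simp)
  moreover have "avoids_122_213 (map Suc u @ 1 # replicate (k - 1) 1)"
    by (rule avoids_if_tail_in_12)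
      (use pos props in \<open>auto simp: filter_map_Suc[simplified] count_list_replicate\<close>)
  then have "avoids_122_213 (append_ones k u)"
    using \<open>k \<ge> 1\<close> by (cases k) (simp_all add: append_ones_def)
  moreover have "set (append_ones k u) \<subseteq> {1..Suc n}"
    using props by (auto simp: append_ones_def)
  ultimately show ?thesis by (simp add: avoiders_def)
qed

lemma insert_two_in_avoiders:
  assumes "u \<in> avoider_stems k n" "i \<in> {1..k}"
  shows "insert_two k (i, u) \<in> avoiders k (Suc n)"
proof -
  note props = assms(1)[unfolded avoider_stems_def avoiders_def mem_Collect_eq]
  from props have pos: "0 \<notin> set u" and "n \<ge> 1" by auto
  have count: "count_list (u @ [1]) a = k" if "a \<in> {1..n}" for a
    using props that by blast
  have "count_list (insert_two k (i, u)) a = k" if "a \<in> {1..Suc n}" for a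
  proof (cases a)
    case (Suc a')
    then consider "a' = 0" | "a' = 1" | "a' > 1" by linarith
    then show ?thesis
    proof cases
      case 1
      with Suc pos assms(2) show ?thesis
        by (simp add: insert_two_def count_list_map_Suc[of _ 0, simplified] count_list_replicate
            count_list_0_iff)
    next
      case 2
      moreover have "count_list (u @ [1]) 1 = k" by (rule count) (use \<open>n \<ge> 1\<close> in simp)
      ultimately show ?thesis
        using Suc count_list_map_Suc[of u 1]
        by (simp add: insert_two_def count_list_replicate numeral_2_eq_2)
    next
      case 3
      moreover have "count_list (u @ [1]) a' = k" by (rule count) (use 3 Suc that in simp)
      ultimately show ?thesis
        using Suc by (simp add: insert_two_def count_list_replicate count_list_map_Suc)
    qed
  qed (use that in simp)
  moreover have "avoids_122_213 (map Suc u @ 1 # replicate (i - 1) 1 @ 2 # replicate (k - i) 1)"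
  proof (rule avoids_if_tail_in_12)
    have "filter (\<lambda>a. a \<noteq> 1) (map Suc u @ 1 # replicate (i - 1) 1 @ 2 # replicate (k - i) 1)
        = map Suc (u @ [1])"
      using pos by (simp add: filter_map_Suc[simplified])
    with props show "avoids_122_213
        (filter (\<lambda>a. a \<noteq> 1) (map Suc u @ 1 # replicate (i - 1) 1 @ 2 # replicate (k - i) 1))"
      by (simp only: avoids_map_Suc)
  qed (use pos in \<open>auto simp: count_list_replicate\<close>)
  then have "avoids_122_213 (insert_two k (i, u))"
    using assms(2) by (cases i) (simp_all add: insert_two_def)
  moreover have "set (insert_two k (i, u)) \<subseteq> {1..Suc n}"
    using props \<open>n \<ge> 1\<close> by (auto simp: insert_two_def)
  ultimately show ?thesis by (simp add: avoiders_def)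
qed

text \<open>Erasing the ones leaves a subsequence, so it creates no occurrence of a pattern.\<close>

lemma lower_in_avoiders:
  assumes "w \<in> avoiders k (Suc n)"
    and eq: "filter (\<lambda>a. a \<noteq> 1) w = map Suc u"
  shows "u \<in> avoiders k n"
proof -
  note props = assms(1)[unfolded avoiders_def mem_Collect_eq]
  have "avoids_122_213 (filter (\<lambda>a. a \<noteq> 1) w)"
    using props by (auto intro: avoids_subseq)
  then have "avoids_122_213 u" by (simp only: eq avoids_map_Suc)
  moreover have range: "Suc a \<in> set w \<and> a \<noteq> 0" if "a \<in> set u" for a
  proof -
    have "Suc a \<in> set (filter (\<lambda>a. a \<noteq> 1) w)" using that by (simp only: eq set_map imageI)
    then show ?thesis by simp
  qed
  have "set u \<subseteq> {1..n}"
    using range props by force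
  moreover have "count_list u a = k" if "a \<in> {1..n}" for a
  proof -
    have "count_list u a = count_list (filter (\<lambda>a. a \<noteq> 1) w) (Suc a)"
      by (simp only: eq count_list_map_Suc)
    also have "\<dots> = count_list w (Suc a)"
      using that by (simp add: count_list_filter)
    finally show ?thesis using that props by simp
  qed
  ultimately show ?thesis by (simp add: avoiders_def)
qed

text \<open>The two cases are whether or not a \<open>2\<close> follows the first \<open>1\<close>. If it does, it is the last letter
  that remains after erasing the ones, and so becomes a final \<open>1\<close> after lowering.\<close>

lemma avoiders_Suc_cases:
  assumes w: "w \<in> avoiders k (Suc n)" and "k \<ge> 2"
  shows "w \<in> append_ones k ` avoiders k n \<union>
             insert_two k ` ({1..k} \<times> avoider_stems k n)"
proof -
  note props = w[unfolded avoiders_def mem_Collect_eq]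
  have count_1: "count_list w 1 = k" using props by simp
  with \<open>k \<ge> 2\<close> have "1 \<in> set w"
    by (metis count_list_0_iff not_numeral_le_zero)
  then obtain p s where ps: "w = p @ 1 # s" "1 \<notin> set p"
    by (metis split_list_first)
  note tail = tail_in_12_if_in_avoiders[OF w ps \<open>k \<ge> 2\<close>]
  define u where "u = map (\<lambda>a. a - 1) p"
  have "0 \<notin> set p" using props ps(1) by auto
  then have p: "p = map Suc u"
    unfolding u_def by (induction p) auto
  have "filter (\<lambda>a. a \<noteq> 1) p = p"
    using ps(2) by (induction p) auto
  then have filter_w: "filter (\<lambda>a. a \<noteq> 1) w = map Suc u @ filter (\<lambda>a. a \<noteq> 1) s"
    using p ps(1) by simp
  have count_s: "count_list s 1 = k - 1"
    using count_1 ps by (simp add: count_list_0_iff)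
  have ones: "l = replicate (count_list l 1) 1" if "set l \<subseteq> {1}" for l :: "nat list"
    using that by (induction l) auto
  show ?thesis
  proof (cases "2 \<in> set s")
    case False
    with tail(1) have "set s \<subseteq> {1}" by auto
    from ones[OF this] have s: "s = replicate (k - 1) 1" by (simp only: count_s)
    then have "filter (\<lambda>a. a \<noteq> 1) w = map Suc u" unfolding filter_w by simp
    then have "u \<in> avoiders k n" by (rule lower_in_avoiders[OF w])
    moreover have "w = append_ones k u"
      using \<open>k \<ge> 2\<close> by (cases k) (simp_all add: append_ones_def ps(1) p s)
    ultimately show ?thesis by blast
  next
    case True
    then have "count_list s 2 \<noteq> 0" by (simp add: count_list_0_iff)
    obtain l r where lr: "s = l @ 2 # r" using True by (metis split_list)
    then have "count_list l 2 = 0" "count_list r 2 = 0" using tail(2) by auto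
    then have "set l \<subseteq> {1}" "set r \<subseteq> {1}"
      using tail(1) lr by (auto simp: count_list_0_iff)
    moreover define i where "i = Suc (count_list l 1)"
    have "count_list l 1 + count_list r 1 = k - 1" using count_s lr by simp
    then have "count_list l 1 = i - 1" "count_list r 1 = k - i" "i \<in> {1..k}"
      using \<open>k \<ge> 2\<close> by (auto simp: i_def)
    ultimately have i: "l = replicate (i - 1) 1" "r = replicate (k - i) 1" "i \<in> {1..k}"
      using ones by metis+
    have "filter (\<lambda>a. a \<noteq> 1) w = map Suc (u @ [1])"
      unfolding filter_w lr i(1,2) by simp
    then have "u @ [1] \<in> avoiders k n" by (rule lower_in_avoiders[OF w])
    then have "u \<in> avoider_stems k n" by (simp add: avoider_stems_def)
    moreover have "w = insert_two k (i, u)"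
      unfolding insert_two_def ps(1) lr p i(1) i(2) using i(3) by (cases i) simp_all
    ultimately show ?thesis using i(3) by blast
  qed
qed

lemma avoiders_Suc_eq:
  assumes "k \<ge> 2"
  shows "avoiders k (Suc n) =
    append_ones k ` avoiders k n \<union> insert_two k ` ({1..k} \<times> avoider_stems k n)"
  using avoiders_Suc_cases append_ones_in_avoiders insert_two_in_avoiders assms by fastforce

section \<open>Counting\<close>

lemma pos_avoider_stems: "u \<in> avoider_stems k n \<Longrightarrow> 0 \<notin> set u"
  by (auto simp: avoider_stems_def avoiders_def)

lemma pos_avoiders: "u \<in> avoiders k n \<Longrightarrow> 0 \<notin> set u"
  by (auto simp: avoiders_def)

lemma finite_avoider_stems: "finite (avoider_stems k n)"
  using finite_vimageI[OF finite_avoiders, of "\<lambda>u. u @ [1]" k n]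
  by (simp add: inj_def vimage_def avoider_stems_def)

lemma cut_at_first_1:
  assumes "0 \<notin> set u" "j \<ge> 1"
  shows "takeWhile (\<lambda>a. a \<noteq> 1) (map Suc u @ replicate j 1 @ s) = map Suc u"
    and "dropWhile (\<lambda>a. a \<noteq> 1) (map Suc u @ replicate j 1 @ s) = replicate j 1 @ s"
proof -
  obtain m where "j = Suc m" using assms(2) by (cases j) auto
  with assms(1) show "takeWhile (\<lambda>a. a \<noteq> 1) (map Suc u @ replicate j 1 @ s) = map Suc u"
    and "dropWhile (\<lambda>a. a \<noteq> 1) (map Suc u @ replicate j 1 @ s) = replicate j 1 @ s"
    by (induction u) auto
qed

lemma inj_append_ones: "inj_on (append_ones k) A"
  by (auto simp: inj_on_def append_ones_def)

text \<open>The word \<open>insert_two k (i, u)\<close> determines \<open>u\<close> as the part before the first \<open>1\<close>, and then \<open>i\<close> as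
  the number of ones before the next \<open>2\<close>.\<close>

lemma inj_insert_two: "inj_on (insert_two k) ({1..k} \<times> avoider_stems k n)"
proof (rule inj_onI, clarify)
  fix i u j v
  assume u: "u \<in> avoider_stems k n" "v \<in> avoider_stems k n" and ij: "i \<in> {1..k}" "j \<in> {1..k}"
    and eq: "insert_two k (i, u) = insert_two k (j, v)"
  have before: "takeWhile (\<lambda>a. a \<noteq> 1) (insert_two k (m, x)) = map Suc x"
    if "x \<in> avoider_stems k n" "m \<in> {1..k}" for m x
    unfolding insert_two_def prod.case
    by (rule cut_at_first_1) (use that pos_avoider_stems in auto)
  have "map Suc u = map Suc v" using before[OF u(1) ij(1)] before[OF u(2) ij(2)] eq by metis
  then have "u = v" by simp
  with eq have tails:
    "replicate i (1::nat) @ 2 # replicate (k - i) 1 = replicate j 1 @ 2 # replicate (k - j) 1"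
    by (simp add: insert_two_def)
  have "takeWhile (\<lambda>a. a = 1) (replicate m (1::nat) @ 2 # x) = replicate m 1" for m x
    by (induction m) auto
  with tails have "replicate i (1::nat) = replicate j 1" by metis
  then have "length (replicate i (1::nat)) = length (replicate j (1::nat))" by (rule arg_cong)
  with \<open>u = v\<close> show "i = j \<and> u = v" by simp
qed

lemma append_ones_neq_insert_two:
  assumes "0 \<notin> set u" "0 \<notin> set v" "i \<in> {1..k}"
  shows "append_ones k u \<noteq> insert_two k (i, v)"
proof
  assume eq: "append_ones k u = insert_two k (i, v)"
  have "dropWhile (\<lambda>a. a \<noteq> 1) (append_ones k u) = replicate k 1"
    using cut_at_first_1(2)[of u k "[]"] assms(1,3) by (simp add: append_ones_def)
  moreover have "dropWhile (\<lambda>a. a \<noteq> 1) (insert_two k (i, v)) =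
      replicate i 1 @ 2 # replicate (k - i) 1"
    using cut_at_first_1(2)[of v i] assms(2,3) by (simp add: insert_two_def)
  ultimately have "replicate k (1::nat) = replicate i 1 @ 2 # replicate (k - i) 1"
    using eq by metis
  then have "(2::nat) \<in> set (replicate k 1)" by simp
  then show False by simp
qed

text \<open>With \<open>I = {1..k}\<close> this counts all avoiding words over one more letter, with \<open>I = {1..<k}\<close> those
  that end in \<open>1\<close>.\<close>

lemma card_append_ones_insert_two:
  assumes "I \<subseteq> {1..k}"
  shows "card (append_ones k ` avoiders k n \<union> insert_two k ` (I \<times> avoider_stems k n)) =
    card (avoiders k n) + card I * card (avoider_stems k n)"
proof -
  have "finite I" using assms finite_subset by blast
  have disjoint: "append_ones k ` avoiders k n \<inter> insert_two k ` (I \<times> avoider_stems k n) = {}"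
    using append_ones_neq_insert_two pos_avoiders pos_avoider_stems assms by blast
  have "inj_on (insert_two k) (I \<times> avoider_stems k n)"
    by (rule inj_on_subset[OF inj_insert_two]) (use assms in blast)
  then show ?thesis
    using \<open>finite I\<close> finite_avoiders finite_avoider_stems
    by (subst card_Un_disjoint[OF _ _ disjoint])
      (simp_all add: card_image inj_append_ones card_cartesian_product)
qed

lemma card_avoiders_Suc:
  assumes "k \<ge> 2"
  shows "card (avoiders k (Suc n)) = card (avoiders k n) + k * card (avoider_stems k n)"
  using card_append_ones_insert_two[of "{1..k}" k n] by (simp add: avoiders_Suc_eq[OF assms])

lemma card_avoider_stems_Suc:
  assumes "k \<ge> 2"
  shows "card (avoider_stems k (Suc n)) =
    card (avoiders k n) + (k - 1) * card (avoider_stems k n)"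
proof -
  have last_append_ones: "last (append_ones k u) = 1" for u
    using assms by (simp add: append_ones_def last_append)
  have last_insert_two: "last (insert_two k (i, u)) = 1 \<longleftrightarrow> i < k" for i u
    by (simp add: insert_two_def last_append)
  have nonempty: "w \<noteq> []" if "w \<in> avoiders k (Suc n)" for w
    using that assms by (auto simp: avoiders_def)
  have "(\<lambda>u. u @ [1]) ` avoider_stems k (Suc n) = {w \<in> avoiders k (Suc n). last w = 1}"
  proof (intro equalityI subsetI)
    fix w assume "w \<in> {w \<in> avoiders k (Suc n). last w = 1}"
    then have "w \<in> avoiders k (Suc n)" "last w = 1" by simp_all
    then have w: "w \<in> avoiders k (Suc n)" "w = butlast w @ [1]"
      using append_butlast_last_id[OF nonempty[of w]] by simp_all
    then have "butlast w \<in> avoider_stems k (Suc n)"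
      unfolding avoider_stems_def mem_Collect_eq by metis
    with w(2) show "w \<in> (\<lambda>u. u @ [1]) ` avoider_stems k (Suc n)" by (rule image_eqI)
  qed (auto simp: avoider_stems_def)
  also have "\<dots> = append_ones k ` avoiders k n \<union> insert_two k ` ({1..<k} \<times> avoider_stems k n)"
    unfolding avoiders_Suc_eq[OF assms]
    by (auto simp: last_append_ones[simplified] last_insert_two[simplified])
  finally have "card ((\<lambda>u. u @ [1]) ` avoider_stems k (Suc n)) =
      card (avoiders k n) + (k - 1) * card (avoider_stems k n)"
    using card_append_ones_insert_two[of "{1..<k}" k n] by (simp add: subset_iff)
  then show ?thesis by (simp add: card_image inj_on_def)
qed

lemma card_avoiders_0: "card (avoiders k 0) = 1"
proof -
  have "avoiders k 0 = {[]}" by (auto simp: avoiders_def avoids_122_213_def)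
  then show ?thesis by simp
qed

lemma card_avoider_stems_0: "card (avoider_stems k 0) = 0"
  by (simp add: avoider_stems_def avoiders_def)

theorem theorem2:
  fixes k n :: nat
  assumes "k \<ge> 2"
  shows "b k n = card (Av k n {[1, 2, 2], [2, 1, 3]})"
  unfolding Av_eq_avoiders
  using assms
proof (induction k n rule: b.induct)
  case (3 k n)
  let ?a = "\<lambda>n. card (avoiders k n)" and ?c = "\<lambda>n. card (avoider_stems k n)"
  \<comment> \<open>The words over \<open>[n + 1]\<close> that do not end in \<open>1\<close> are those with \<open>2\<close> behind all ones.\<close>
  have "?a (Suc n) = ?c (Suc n) + ?c n"
    using card_avoiders_Suc[OF 3(3), of n] card_avoider_stems_Suc[OF 3(3), of n] 3(3)
    by (cases k) simp_all
  then have "k * ?a (Suc n) + ?a n = k * ?c (Suc n) + (?a n + k * ?c n)"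
    by (simp add: algebra_simps)
  also have "\<dots> = ?a (Suc (Suc n))"
    by (simp add: card_avoiders_Suc[OF 3(3)])
  finally show ?case using 3 by (simp only: b.simps)
next
  case (2 k)
  then show ?case by (simp only: b.simps card_avoiders_Suc card_avoiders_0 card_avoider_stems_0)
qed (simp add: card_avoiders_0)

end
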